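(* Let $\mathcal{H}$ be a Hilbert space and let $T:\mathcal{H}\to\mathcal{H}$ be a normal linear operator. Then there are $A,B\in\mathcal{L}(\mathcal{H})$ such that the following four assertions hold: (i) $A$ is injective. (ii) $T=A^{-1}B$. (iii) $AB=BA$. (iv) $A$ is self-adjoint and $B$ is normal. Moreover, if $T$ is self-adjoint, then so is $B$.
   Context: $\mathcal{L}(\mathcal{H})$ denotes the set of all bounded linear operators on $\mathcal{H}$ (defined on all of $\mathcal{H}$). A linear operator $T:\mathcal{H}\to\mathcal{H}$ is not assumed to be bounded or everywhere defined: it is a linear map from a linear subspace $\mathcal{D}(T)\subset\mathcal{H}$ (its domain) into $\mathcal{H}$, with range $\mathcal{R}(T)$. Equality $T=S$ of operators means $\mathcal{D}(T)=\mathcal{D}(S)$ and $Tx=Sx$ for all $x\in\mathcal{D}(T)$. The product of operators has its natural domain $\mathcal{D}(ST)=\{x\in\mathcal{D}(T): Tx\in\mathcal{D}(S)\}$. For an injective operator $A$, $A^{-1}$ is the inverse operator with domain $\mathcal{D}(A^{-1})=\mathcal{R}(A)$; thus $\mathcal{D}(A^{-1}B)=\{x\in\mathcal{H}: Bx\in\mathcal{R}(A)\}$. $T$ is densely defined if $\mathcal{D}(T)$ is dense in $\mathcal{H}$, and then $T^{*}$ denotes its adjoint operator. A densely defined operator $T$ is normal if $T^{*}T=TT^{*}$ (equality of operators, including domains). A densely defined operator $T$ is self-adjoint if $T^{*}=T$.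
   Formalization: The operator T is additionally assumed closed; without this, an injective densely defined T with dense graph has T*T = TT* = 0 on {0}, hence is normal as defined, but cannot equal A^{-1}B, which is always closed. *)

theory Defs
  imports "HOL-Analysis.Analysis"
begin

text \<open>
  The scalar field of a Hilbert space is \<open>\<real>\<close> or \<open>\<complex>\<close>. By the Gelfand--Mazur theorem
  these are, up to isomorphism, the only real normed fields; the class adds the conjugation.
\<close>

class hilbert_scalar = real_normed_field +
  fixes scnj :: "'a \<Rightarrow> 'a"
  assumes scnj_add: "scnj (a + b) = scnj a + scnj b"
    and scnj_mult: "scnj (a * b) = scnj a * scnj b"
    and scnj_scnj: "scnj (scnj a) = a"
    and mult_scnj: "a * scnj a = (norm a)\<^sup>2 *\<^sub>R 1"

instantiation real :: hilbert_scalar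
begin

definition scnj_real :: "real \<Rightarrow> real"
  where "scnj_real a = a"

instance
  by standard (simp_all add: scnj_real_def power2_eq_square)

end

instantiation complex :: hilbert_scalar
begin

definition scnj_complex :: "complex \<Rightarrow> complex"
  where "scnj_complex = cnj"

instance
  by standard (simp_all add: scnj_complex_def flip: complex_norm_square of_real_def)

end

text \<open>
  The inner product is linear in its first argument and induces the norm of the
  type \<open>'a\<close>; completeness is part of the class \<^class>\<open>banach\<close>.
\<close>

locale hilbert_space = vector_space smul
  for smul :: "'k::hilbert_scalar \<Rightarrow> 'a::banach \<Rightarrow> 'a" +
  fixes ip :: "'a \<Rightarrow> 'a \<Rightarrow> 'k"
  assumes scale_of_real: "smul (of_real r) x = r *\<^sub>R x"
    and ip_add_left: "ip (x + y) z = ip x z + ip y z"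
    and ip_scale_left: "ip (smul c x) y = c * ip x y"
    and ip_commute: "ip y x = scnj (ip x y)"
    and ip_self: "ip x x = of_real ((norm x)\<^sup>2)"

text \<open>
  Operators in \<open>'a\<close> are partial functions \<open>'a \<rightharpoonup> 'a\<close>, the domain of \<open>T\<close> being \<open>dom T\<close>.
  Equality of such functions is equality of domains and of all values, and \<open>S \<circ>\<^sub>m T\<close> is the
  product \<open>S T\<close> with its natural domain \<open>{x \<in> dom T. the (T x) \<in> dom S}\<close>.
\<close>

definition linear_operator :: "('k::hilbert_scalar \<Rightarrow> 'a::banach \<Rightarrow> 'a) \<Rightarrow> ('a \<rightharpoonup> 'a) \<Rightarrow> bool"
  where "linear_operator smul T \<longleftrightarrow>
    module.subspace smul (dom T) \<and>
    (\<forall>x\<in>dom T. \<forall>y\<in>dom T. the (T (x + y)) = the (T x) + the (T y)) \<and>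
    (\<forall>c. \<forall>x\<in>dom T. the (T (smul c x)) = smul c (the (T x)))"

definition bounded_operators :: "('k::hilbert_scalar \<Rightarrow> 'a::banach \<Rightarrow> 'a) \<Rightarrow> ('a \<rightharpoonup> 'a) set"
  where "bounded_operators smul =
    {A. linear_operator smul A \<and> dom A = UNIV \<and> bounded_linear (\<lambda>x. the (A x))}"

definition injective_operator :: "('a \<rightharpoonup> 'a) \<Rightarrow> bool"
  where "injective_operator A \<longleftrightarrow> inj_on (\<lambda>x. the (A x)) (dom A)"

definition inverse_operator :: "('a \<rightharpoonup> 'a) \<Rightarrow> ('a \<rightharpoonup> 'a)"
  where "inverse_operator A =
    (\<lambda>y. if y \<in> ran A then Some (the_inv_into (dom A) (\<lambda>x. the (A x)) y) else None)"

definition densely_defined :: "('a::banach \<rightharpoonup> 'a) \<Rightarrow> bool"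
  where "densely_defined T \<longleftrightarrow> closure (dom T) = UNIV"

definition closed_operator :: "('a::banach \<rightharpoonup> 'a) \<Rightarrow> bool"
  where "closed_operator T \<longleftrightarrow> closed (Map.graph T)"

text \<open>The vector \<open>z\<close> below is unique if \<open>T\<close> is densely defined; otherwise the value is arbitrary.\<close>

definition adjoint_operator ::
    "('a::banach \<Rightarrow> 'a \<Rightarrow> 'k::hilbert_scalar) \<Rightarrow> ('a \<rightharpoonup> 'a) \<Rightarrow> ('a \<rightharpoonup> 'a)"
  where "adjoint_operator ip T =
    (\<lambda>y. if \<exists>z. \<forall>x\<in>dom T. ip (the (T x)) y = ip x z
         then Some (THE z. \<forall>x\<in>dom T. ip (the (T x)) y = ip x z) else None)"

definition self_adjoint_operator ::
    "('a::banach \<Rightarrow> 'a \<Rightarrow> 'k::hilbert_scalar) \<Rightarrow> ('a \<rightharpoonup> 'a) \<Rightarrow> bool"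
  where "self_adjoint_operator ip T \<longleftrightarrow> densely_defined T \<and> adjoint_operator ip T = T"

text \<open>
  Closedness is not implied by this definition: an injective densely defined \<open>T\<close> whose graph is
  dense has an adjoint with domain \<open>{0}\<close>, so both products below are the zero operator on \<open>{0}\<close>.
  Unbounded normal operators are therefore additionally required to satisfy \<^const>\<open>closed_operator\<close>
  (\<open>A\<^sup>-\<^sup>1 B\<close> is always closed for bounded \<open>A\<close>, \<open>B\<close> with \<open>A\<close> injective).
\<close>

definition normal_operator ::
    "('a::banach \<Rightarrow> 'a \<Rightarrow> 'k::hilbert_scalar) \<Rightarrow> ('a \<rightharpoonup> 'a) \<Rightarrow> bool"
  where "normal_operator ip T \<longleftrightarrow> densely_defined T \<and>
    adjoint_operator ip T \<circ>\<^sub>m T = T \<circ>\<^sub>m adjoint_operator ip T"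

end

theory Submission
  imports Defs
begin

text \<open>
  Take \<open>A = (I + T\<^sup>* T)\<^sup>-\<^sup>1\<close> and \<open>B = T A\<close>. Surjectivity of \<open>I + T\<^sup>* T\<close> follows by projecting
  \<open>(x, 0)\<close> orthogonally onto the graph of \<open>T\<close>, a closed subspace of \<open>\<H> \<times> \<H>\<close>. Normality gives
  \<open>A T \<subseteq> T A\<close> and \<open>A T\<^sup>* \<subseteq> T\<^sup>* A\<close>, whence \<open>B\<^sup>* = T\<^sup>* A\<close>, and \<open>T\<close> is recovered as \<open>A\<^sup>-\<^sup>1 B\<close>
  because \<open>T A x \<in> \<R>(A)\<close> forces \<open>T\<^sup>* T A x\<close>, and hence \<open>x\<close>, into the domain of \<open>T\<close>.
\<close>

section \<open>Conjugation and elementary identities for the inner product\<close>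

text \<open>The class axioms do not mention the reals: for \<open>r \<noteq> 0\<close> cancel
  \<open>r\<close> in \<open>mult_scnj\<close>, for 0 use additivity.\<close>

lemma scnj_of_real [simp]: "scnj (of_real r :: 'k::hilbert_scalar) = of_real r"
proof (cases "r = 0")
  case True
  have "scnj (0::'k) + scnj 0 = scnj 0"
    by (metis scnj_add add_0)
  then show ?thesis using True by simp
next
  case False
  have "(of_real r :: 'k) * scnj (of_real r) = of_real r * of_real r"
    by (simp add: mult_scnj power2_eq_square of_real_def)
  then show ?thesis using False by simp
qed

lemma scnj_zero [simp]: "scnj (0 :: 'k::hilbert_scalar) = 0"
  using scnj_of_real [of 0] by simp

context hilbert_space
begin

lemma ip_scale_right: "ip x (smul c y) = scnj c * ip x y"
  by (metis ip_commute ip_scale_left scnj_mult)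

lemma ip_add_right: "ip x (y + z) = ip x y + ip x z"
  by (metis ip_commute ip_add_left scnj_add)

lemma ip_zero_left [simp]: "ip 0 x = 0"
  using ip_add_left [of 0 0 x] by simp

lemma ip_zero_right [simp]: "ip x 0 = 0"
  using ip_add_right [of x 0 0] by simp

lemma ip_minus_left: "ip (- x) y = - ip x y"
  using ip_add_left [of x "- x" y] by (simp add: eq_neg_iff_add_eq_0 add.commute)

lemma ip_minus_right: "ip x (- y) = - ip x y"
  using ip_add_right [of x y "- y"] by (simp add: eq_neg_iff_add_eq_0 add.commute)

lemma ip_diff_left: "ip (x - y) z = ip x z - ip y z"
  using ip_add_left [of x "- y" z] by (simp add: ip_minus_left)

lemma ip_diff_right: "ip x (y - z) = ip x y - ip x z"
  using ip_add_right [of x y "- z"] by (simp add: ip_minus_right)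

lemma of_real_norm_square_add:
  "of_real ((norm (x + y))\<^sup>2) = of_real ((norm x)\<^sup>2) + ip x y + ip y x + of_real ((norm y)\<^sup>2)"
  by (simp only: ip_self [symmetric] ip_add_left ip_add_right add_ac)

text \<open>A real \<open>ip x y\<close> equals its conjugate \<open>ip y x\<close>, so the two
  cross terms add up. The case \<open>r = 0\<close> is Pythagoras.\<close>

lemma norm_square_add:
  assumes "ip x y = of_real r"
  shows "(norm (x + y))\<^sup>2 = (norm x)\<^sup>2 + 2 * r + (norm y)\<^sup>2"
proof -
  have "ip y x = of_real r"
    using assms ip_commute [of y x] by simp
  then have "ip (x + y) (x + y) = of_real ((norm x)\<^sup>2 + 2 * r + (norm y)\<^sup>2)"
    unfolding ip_self of_real_norm_square_add using assms by simp
  then show ?thesis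
    by (simp only: ip_self of_real_eq_iff)
qed

section \<open>Orthogonal projection onto closed subspaces\<close>

lemma parallelogram_law:
  "(norm (x + y))\<^sup>2 + (norm (x - y))\<^sup>2 = 2 * (norm x)\<^sup>2 + 2 * (norm y)\<^sup>2"
  for x y :: 'a
proof -
  have "ip (x + y) (x + y) + ip (x - y) (x - y)
      = of_real (2 * (norm x)\<^sup>2 + 2 * (norm y)\<^sup>2)"
    using of_real_norm_square_add [of x y] of_real_norm_square_add [of x "- y"]
    by (simp add: ip_self ip_minus_left ip_minus_right)
  then show ?thesis
    by (simp only: ip_self of_real_eq_iff flip: of_real_add)
qed

lemma minimal_norm_imp_orthogonal:
  assumes "\<And>c. norm w \<le> norm (w - smul c s)"
  shows "ip s w = 0"
proof (cases "s = 0")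
  case False
  define n where "n = (norm s)\<^sup>2"
  have "n > 0"
    using False by (simp add: n_def)
  define k where "k = ip w s"
  \<comment> \<open>\<open>smul c s\<close> is the projection of \<open>w\<close> onto the line
    through \<open>s\<close>; subtracting it lowers the squared norm by exactly
    \<open>(norm k)\<^sup>2 / n\<close>.\<close>
  define c where "c = of_real (1 / n) * k"
  have sw: "ip s w = scnj k"
    unfolding k_def by (rule ip_commute)
  have kk: "k * scnj k = of_real ((norm k)\<^sup>2)"
    by (simp add: mult_scnj of_real_def)
  have "ip (w - smul c s) (w - smul c s)
      = ip w w - scnj c * k - c * scnj k + c * scnj c * ip s s"
    by (simp add: ip_diff_left ip_diff_right ip_scale_left ip_scale_right sw k_def[symmetric]
        algebra_simps)
  also have "\<dots> = of_real ((norm w)\<^sup>2) - of_real (1 / n) * (k * scnj k)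
      - of_real (1 / n) * (k * scnj k)
      + of_real (1 / n) * of_real (1 / n) * of_real n * (k * scnj k)"
    by (simp only: c_def scnj_mult scnj_of_real ip_self n_def mult_ac)
  also have "\<dots> = of_real ((norm w)\<^sup>2 - (1 / n) * (norm k)\<^sup>2 - (1 / n) * (norm k)\<^sup>2
      + (1 / n) * (1 / n) * n * (norm k)\<^sup>2)"
    unfolding kk by (simp only: of_real_add of_real_diff of_real_mult)
  also have "(1 / n) * (1 / n) * n * (norm k)\<^sup>2 = (1 / n) * (norm k)\<^sup>2"
    using \<open>n > 0\<close> by simp
  finally have "(norm (w - smul c s))\<^sup>2 = (norm w)\<^sup>2 - (1 / n) * (norm k)\<^sup>2"
    unfolding ip_self of_real_eq_iff by simp
  moreover have "(norm w)\<^sup>2 \<le> (norm (w - smul c s))\<^sup>2"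
    using assms by (simp add: power_mono)
  ultimately have "(1 / n) * (norm k)\<^sup>2 \<le> 0"
    by linarith
  then have "(norm k)\<^sup>2 \<le> 0"
    using \<open>n > 0\<close> by (simp add: divide_le_0_iff)
  then have "k = 0" by simp
  then show ?thesis using sw by simp
qed simp

text \<open>The sets \<open>C n\<close> of near-minimisers are closed, nonempty and nested, and the
  parallelogram law makes their diameters shrink to 0; completeness yields a common point.\<close>

lemma closed_subspace_nearest_point:
  assumes "subspace S" "closed S"
  obtains p where "p \<in> S" "\<And>s. s \<in> S \<Longrightarrow> norm (x - p) \<le> norm (x - s)"
proof -
  define f where "f s = (norm (x - s))\<^sup>2" for s
  define D where "D = Inf (f ` S)"
  have bdd: "bdd_below (f ` S)"
    by (rule bdd_belowI [of _ 0]) (auto simp: f_def)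
  have D_le: "D \<le> f s" if "s \<in> S" for s
    unfolding D_def using bdd that by (simp add: cINF_lower)
  have "0 \<in> S"
    using assms(1) by (rule subspace_0)
  define C where "C n = {s \<in> S. f s \<le> D + inverse (real (Suc n))}" for n
  have "closed (C n)" for n
  proof -
    have "C n = S \<inter> {s. f s \<le> D + inverse (real (Suc n))}"
      by (auto simp: C_def)
    moreover have "closed {s. f s \<le> D + inverse (real (Suc n))}"
      unfolding f_def by (intro closed_Collect_le continuous_intros)
    ultimately show ?thesis
      using assms(2) by auto
  qed
  moreover have "C n \<noteq> {}" for n
  proof -
    have "\<exists>y \<in> f ` S. y < D + inverse (real (Suc n))"
      unfolding D_def using \<open>0 \<in> S\<close> bdd by (intro iffD1 [OF cInf_less_iff]) auto
    then show ?thesis by (force simp: C_def)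
  qed
  moreover have "C n \<subseteq> C m" if "m \<le> n" for m n
  proof -
    have "inverse (real (Suc n)) \<le> inverse (real (Suc m))"
      using that by simp
    then show ?thesis
      unfolding C_def by (auto intro: order_trans)
  qed
  moreover have "\<exists>n. \<forall>a\<in>C n. \<forall>b\<in>C n. dist a b < e" if "e > 0" for e
  proof -
    obtain n where n: "inverse (real (Suc n)) < e\<^sup>2 / 4"
      using reals_Archimedean [of "e\<^sup>2 / 4"] \<open>e > 0\<close> by auto
    have "dist a b < e" if "a \<in> C n" "b \<in> C n" for a b
    proof -
      \<comment> \<open>The midpoint of \<open>a\<close> and \<open>b\<close> stays in
        \<open>S\<close>, so \<open>D \<le> f m\<close>; this lower bound is what forces
        \<open>a\<close> and \<open>b\<close> together.\<close>
      define m where "m = smul (of_real (1/2)) (a + b)"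
      have "m \<in> S"
        using that assms(1) unfolding m_def C_def by (blast intro: subspace_scale subspace_add)
      have "(x - a) + (x - b) = 2 *\<^sub>R (x - m)"
        unfolding m_def scale_of_real by (simp add: algebra_simps scaleR_2)
      then have "(norm ((x - a) + (x - b)))\<^sup>2 = 4 * f m"
        by (simp add: f_def power_mult_distrib)
      moreover have "norm ((x - a) - (x - b)) = dist a b"
        by (simp add: dist_norm norm_minus_commute)
      ultimately have "(dist a b)\<^sup>2 = 2 * f a + 2 * f b - 4 * f m"
        using parallelogram_law [of "x - a" "x - b"] by (simp add: f_def)
      also have "\<dots> \<le> 4 * inverse (real (Suc n))"
        using D_le [OF \<open>m \<in> S\<close>] that unfolding C_def by simp
      also have "\<dots> < e\<^sup>2"
        using n by simp
      finally show ?thesis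
        using \<open>e > 0\<close> by (simp add: power_less_imp_less_base)
    qed
    then show ?thesis by blast
  qed
  ultimately obtain p where p: "\<And>n. p \<in> C n"
    by (rule decreasing_closed_nest) blast+
  have "f p \<le> D"
  proof (rule field_le_epsilon)
    fix e :: real
    assume "e > 0"
    then obtain n where "inverse (real (Suc n)) < e"
      using reals_Archimedean by blast
    then show "f p \<le> D + e"
      using p [of n] by (simp add: C_def)
  qed
  then have "norm (x - p) \<le> norm (x - s)" if "s \<in> S" for s
    using D_le [OF that] unfolding f_def by (meson norm_ge_zero order_trans power2_le_imp_le)
  moreover have "p \<in> S"
    using p by (simp add: C_def)
  ultimately show ?thesis
    using that by blast
qed

lemma orthogonal_projection_exists:
  assumes "subspace S" "closed S"
  obtains p where "p \<in> S" "\<And>s. s \<in> S \<Longrightarrow> ip s (x - p) = 0"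
proof -
  obtain p where p: "p \<in> S" "\<And>s. s \<in> S \<Longrightarrow> norm (x - p) \<le> norm (x - s)"
    using closed_subspace_nearest_point [OF assms] by blast
  have "ip s (x - p) = 0" if "s \<in> S" for s
  proof (rule minimal_norm_imp_orthogonal)
    fix c
    have "p + smul c s \<in> S"
      using p(1) that assms(1) by (simp add: subspace_add subspace_scale)
    from p(2) [OF this] show "norm (x - p) \<le> norm (x - p - smul c s)"
      by (simp add: diff_diff_add)
  qed
  then show ?thesis
    using that p(1) by blast
qed

text \<open>Makes the projection lemma available for graphs of operators. The norm of the product
  type is already the Euclidean one, so it is induced by the sum of the inner products.\<close>

lemma hilbert_space_prod:
  "hilbert_space (\<lambda>c p. (smul c (fst p), smul c (snd p)))
    (\<lambda>p q. ip (fst p) (fst q) + ip (snd p) (snd q))"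
proof (unfold_locales, goal_cases)
  \<comment> \<open>Goals 8 and 9 are \<open>ip_commute\<close> and \<open>ip_self\<close>; the
    others hold componentwise.\<close>
  case (8 x y)
  show ?case
    by (simp add: scnj_add flip: ip_commute)
next
  case (9 x)
  then show ?case
    by (simp add: ip_self norm_prod_def)
qed (simp_all add: prod_eq_iff scale_right_distrib scale_left_distrib scale_of_real
    ip_add_left ip_scale_left distrib_left add_ac)


section \<open>Adjoints and everywhere defined operators\<close>

lemma orthogonal_dense_imp_zero:
  assumes "closure S = UNIV" "\<And>x. x \<in> S \<Longrightarrow> ip x z = 0"
  shows "z = 0"
proof (rule ccontr)
  assume "z \<noteq> 0"
  then obtain x where x: "x \<in> S" "norm (x - z) < norm z"
    using assms(1) by (metis UNIV_I closure_approachable dist_norm zero_less_norm_iff)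
  have "(norm (x - z))\<^sup>2 = (norm x)\<^sup>2 + (norm z)\<^sup>2"
    using norm_square_add [of x "- z" 0] assms(2) [OF x(1)] by (simp add: ip_minus_right)
  then have "(norm z)\<^sup>2 \<le> (norm (x - z))\<^sup>2"
    by simp
  then show False
    using x(2) by (meson norm_ge_zero not_le power2_le_imp_le)
qed

text \<open>Density makes the representing vector unique, which eliminates the definite description
  from all later arguments.\<close>

lemma adjoint_operator_eq_Some_iff:
  assumes "densely_defined S"
  shows "adjoint_operator ip S y = Some z \<longleftrightarrow> (\<forall>x v. S x = Some v \<longrightarrow> ip v y = ip x z)"
proof -
  define P where "P z \<longleftrightarrow> (\<forall>x\<in>dom S. ip (the (S x)) y = ip x z)" for z
  have "z1 = z2" if "P z1" "P z2" for z1 z2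
    using orthogonal_dense_imp_zero [of "dom S" "z1 - z2"] that assms
    by (simp add: P_def ip_diff_right densely_defined_def)
  then have "(THE z. P z) = z" if "P z" for z
    using that by blast
  then have "adjoint_operator ip S y = Some z \<longleftrightarrow> P z"
    unfolding adjoint_operator_def P_def [symmetric] by auto
  then show ?thesis
    unfolding P_def by force
qed

lemma densely_defined_total: "densely_defined (\<lambda>x. Some (f x))"
  by (simp add: densely_defined_def dom_def)

lemma adjoint_operator_total:
  assumes "\<And>x y. ip (f x) y = ip x (g y)"
  shows "adjoint_operator ip (\<lambda>x. Some (f x)) = (\<lambda>x. Some (g x))"
proof
  fix y
  show "adjoint_operator ip (\<lambda>x. Some (f x)) y = Some (g y)"
    by (simp add: adjoint_operator_eq_Some_iff densely_defined_total assms)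
qed

lemma bounded_operators_total:
  assumes "\<And>x y. f (x + y) = f x + f y" "\<And>c x. f (smul c x) = smul c (f x)"
    "\<And>x. norm (f x) \<le> norm x"
  shows "(\<lambda>x. Some (f x)) \<in> bounded_operators smul"
proof -
  have "bounded_linear f"
    \<comment> \<open>Real homogeneity is homogeneity under \<open>smul\<close> restricted to
      scalars \<open>of_real r\<close>.\<close>
    using assms(1,3) assms(2) [of "of_real _", unfolded scale_of_real]
    by (intro bounded_linear_intro [of _ 1]) auto
  then show ?thesis
    using assms(1,2) by (simp add: bounded_operators_def linear_operator_def subspace_def dom_def)
qed

end

section \<open>Closed densely defined operators and the inverse of \<open>I + T* T\<close>\<close>

locale hilbert_operator = hilbert_space smul ip
  for smul :: "'k::hilbert_scalar \<Rightarrow> 'a::banach \<Rightarrow> 'a" and ip :: "'a \<Rightarrow> 'a \<Rightarrow> 'k" +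
  fixes T :: "'a \<rightharpoonup> 'a"
  assumes linear: "linear_operator smul T"
    and closed: "closed_operator T"
    and dense: "densely_defined T"
begin

abbreviation Tadj :: "'a \<rightharpoonup> 'a"
  where "Tadj \<equiv> adjoint_operator ip T"

lemmas Tadj_iff = adjoint_operator_eq_Some_iff [OF dense]

lemma ip_Tadj: "T x = Some v \<Longrightarrow> Tadj y = Some z \<Longrightarrow> ip v y = ip x z"
  by (simp add: Tadj_iff)

lemma T_add: "T x = Some a \<Longrightarrow> T y = Some b \<Longrightarrow> T (x + y) = Some (a + b)"
  using linear unfolding linear_operator_def
  by (metis domI domIff option.sel option.collapse subspace_add)

lemma T_scale: "T x = Some a \<Longrightarrow> T (smul c x) = Some (smul c a)"
  using linear unfolding linear_operator_def
  by (metis domI domIff option.sel option.collapse subspace_scale)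

lemma T_diff: "T x = Some a \<Longrightarrow> T y = Some b \<Longrightarrow> T (x - y) = Some (a - b)"
  using T_add [of x a "- y" "- b"] T_scale [of y b "- 1"] by simp

lemma T_zero: "T 0 = Some 0"
proof -
  have "0 \<in> dom T"
    using linear subspace_0 unfolding linear_operator_def by blast
  then show ?thesis
    using T_diff [of 0 _ 0] by force
qed

lemma Tadj_add: "Tadj x = Some a \<Longrightarrow> Tadj y = Some b \<Longrightarrow> Tadj (x + y) = Some (a + b)"
  by (simp add: Tadj_iff ip_add_right)

lemma Tadj_scale: "Tadj x = Some a \<Longrightarrow> Tadj (smul c x) = Some (smul c a)"
  by (simp add: Tadj_iff ip_scale_right)

lemma Tadj_diff: "Tadj x = Some a \<Longrightarrow> Tadj y = Some b \<Longrightarrow> Tadj (x - y) = Some (a - b)"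
  by (simp add: Tadj_iff ip_diff_right)

text \<open>In operator notation \<open>x = u + T* T u\<close>, so \<open>I + T* T\<close> is
  onto.\<close>

lemma one_plus_gram_surj:
  obtains u v where "T u = Some v" "Tadj v = Some (x - u)"
proof -
  interpret prod: hilbert_space "\<lambda>c p. (smul c (fst p), smul c (snd p))"
    "\<lambda>p q. ip (fst p) (fst q) + ip (snd p) (snd q)"
    by (rule hilbert_space_prod)
  have "prod.subspace (Map.graph T)"
    by (auto simp: prod.subspace_def Map.graph_def T_add T_scale T_zero zero_prod_def)
  moreover have "closed (Map.graph T)"
    using closed by (simp add: closed_operator_def)
  ultimately obtain p where p: "p \<in> Map.graph T"
    "\<And>s. s \<in> Map.graph T \<Longrightarrow> ip (fst s) (fst ((x, 0) - p)) + ip (snd s) (snd ((x, 0) - p)) = 0"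
    using prod.orthogonal_projection_exists by blast
  obtain u v where uv: "p = (u, v)" "T u = Some v"
    using p(1) by (auto simp: Map.graph_def)
  \<comment> \<open>The residual \<open>(x - u, - v)\<close> is orthogonal to \<open>(a, b)\<close>
    in the graph.\<close>
  have "ip b v = ip a (x - u)" if "T a = Some b" for a b
    using p(2) [of "(a, b)"] that uv(1) by (simp add: Map.graph_def ip_minus_right)
  then have "Tadj v = Some (x - u)"
    by (simp add: Tadj_iff)
  then show ?thesis
    using that uv(2) by blast
qed

text \<open>The cross term \<open>ip u w\<close> equals \<open>ip v v\<close> and hence is real.
  Uniqueness of solutions and the norm bounds both come from this identity.\<close>

lemma norm_one_plus_gram:
  assumes "T u = Some v" "Tadj v = Some w"
  shows "(norm (u + w))\<^sup>2 = (norm u)\<^sup>2 + 2 * (norm v)\<^sup>2 + (norm w)\<^sup>2"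
  using norm_square_add ip_Tadj [OF assms] ip_self by metis

text \<open>This is \<open>A\<close>, the inverse of \<open>I + T* T\<close>;
  \<open>T_resolvent\<close> below is \<open>B = T A\<close>.\<close>

definition resolvent :: "'a \<Rightarrow> 'a"
  where "resolvent x = (THE u. \<exists>v. T u = Some v \<and> Tadj v = Some (x - u))"

definition T_resolvent :: "'a \<Rightarrow> 'a"
  where "T_resolvent x = the (T (resolvent x))"

text \<open>Evaluation rule: exhibiting \<open>u\<close>, \<open>T u\<close> and
  \<open>T* T u\<close> determines \<open>A\<close> and \<open>B\<close> at
  \<open>u + T* T u\<close>.\<close>

lemma resolventI:
  assumes "T u = Some v" "Tadj v = Some w"
  shows resolvent_eq: "resolvent (u + w) = u" and T_resolvent_eq: "T_resolvent (u + w) = v"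
proof -
  show "resolvent (u + w) = u"
    unfolding resolvent_def
  proof (rule the_equality)
    fix u'
    assume "\<exists>v. T u' = Some v \<and> Tadj v = Some (u + w - u')"
    then obtain v' where v': "T u' = Some v'" "Tadj v' = Some (u + w - u')"
      by blast
    \<comment> \<open>The difference of two solutions solves the equation with right-hand side 0, so
      every square on the right vanishes.\<close>
    have "(norm ((u - u') + (w - (u + w - u'))))\<^sup>2
        = (norm (u - u'))\<^sup>2 + 2 * (norm (v - v'))\<^sup>2 + (norm (w - (u + w - u')))\<^sup>2"
      using assms v' by (intro norm_one_plus_gram T_diff Tadj_diff)
    then have "(norm (u - u'))\<^sup>2 + 2 * (norm (v - v'))\<^sup>2 + (norm (w - (u + w - u')))\<^sup>2 = 0"
      by simp
    then have "(norm (u - u'))\<^sup>2 = 0"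
      by (smt (verit) zero_le_power2)
    then show "u' = u" by simp
  qed (use assms in auto)
  then show "T_resolvent (u + w) = v"
    by (simp add: T_resolvent_def assms)
qed

lemma T_resolvent: "T (resolvent x) = Some (T_resolvent x)"
  and Tadj_T_resolvent: "Tadj (T_resolvent x) = Some (x - resolvent x)"
proof -
  obtain u v where uv: "T u = Some v" "Tadj v = Some (x - u)"
    by (rule one_plus_gram_surj)
  then show "T (resolvent x) = Some (T_resolvent x)"
    and "Tadj (T_resolvent x) = Some (x - resolvent x)"
    using resolvent_eq [OF uv] T_resolvent_eq [OF uv] by simp_all
qed

lemma resolvent_add: "resolvent (x + y) = resolvent x + resolvent y"
  and T_resolvent_add: "T_resolvent (x + y) = T_resolvent x + T_resolvent y"
  using resolventI [OF T_add Tadj_add, OF T_resolvent T_resolvent Tadj_T_resolvent Tadj_T_resolvent,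
      of x y] by (simp_all add: algebra_simps)

lemma resolvent_scale: "resolvent (smul c x) = smul c (resolvent x)"
  and T_resolvent_scale: "T_resolvent (smul c x) = smul c (T_resolvent x)"
  using resolventI [OF T_scale Tadj_scale, OF T_resolvent Tadj_T_resolvent, of c x]
  by (simp_all flip: scale_right_distrib)

lemma norm_resolvent_le: "norm (resolvent x) \<le> norm x"
  and norm_T_resolvent_le: "norm (T_resolvent x) \<le> norm x"
proof -
  have "(norm x)\<^sup>2
      = (norm (resolvent x))\<^sup>2 + 2 * (norm (T_resolvent x))\<^sup>2 + (norm (x - resolvent x))\<^sup>2"
    using norm_one_plus_gram [OF T_resolvent Tadj_T_resolvent, of x] by simp
  then have "(norm (resolvent x))\<^sup>2 \<le> (norm x)\<^sup>2" "(norm (T_resolvent x))\<^sup>2 \<le> (norm x)\<^sup>2"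
    by (smt (verit) zero_le_power2)+
  then show "norm (resolvent x) \<le> norm x" "norm (T_resolvent x) \<le> norm x"
    by (auto intro: power2_le_imp_le)
qed

text \<open>Moving \<open>T\<close> across \<open>ip (B x) (B y)\<close> in either direction gives
  \<open>ip (A x) (y - A y)\<close> and \<open>ip (x - A x) (A y)\<close>; the terms
  \<open>ip (A x) (A y)\<close> cancel.\<close>

lemma resolvent_self_adjoint: "ip (resolvent x) y = ip x (resolvent y)"
proof -
  have "ip (T_resolvent x) (T_resolvent y) = ip (resolvent x) (y - resolvent y)"
    by (rule ip_Tadj [OF T_resolvent Tadj_T_resolvent])
  moreover have "ip (T_resolvent y) (T_resolvent x) = ip (resolvent y) (x - resolvent x)"
    by (rule ip_Tadj [OF T_resolvent Tadj_T_resolvent])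
  then have "ip (T_resolvent x) (T_resolvent y) = ip (x - resolvent x) (resolvent y)"
    by (metis ip_commute)
  ultimately show ?thesis
    by (simp add: ip_diff_left ip_diff_right)
qed

text \<open>\<open>A x\<close> determines \<open>B x = T A x\<close>, then
  \<open>T* B x = x - A x\<close>, and so \<open>x\<close>.\<close>

lemma inj_resolvent: "inj resolvent"
proof (rule injI)
  fix x y
  assume "resolvent x = resolvent y"
  then show "x = y"
    by (metis T_resolvent_def Tadj_T_resolvent diff_eq_eq diff_add_cancel option.inject)
qed

end

section \<open>Normal operators: commutation with the resolvent\<close>

locale closed_normal_operator = hilbert_operator smul ip T
  for smul :: "'k::hilbert_scalar \<Rightarrow> 'a::banach \<Rightarrow> 'a" and ip :: "'a \<Rightarrow> 'a \<Rightarrow> 'k" and T +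
  assumes normal: "Tadj \<circ>\<^sub>m T = T \<circ>\<^sub>m Tadj"
begin

lemma normalD1:
  assumes "T u = Some v" "Tadj v = Some w"
  obtains v' where "Tadj u = Some v'" "T v' = Some w"
  using assms fun_cong [OF normal, of u] by (auto simp: map_comp_def split: option.splits)

lemma normalD2:
  assumes "Tadj u = Some v" "T v = Some w"
  obtains v' where "T u = Some v'" "Tadj v' = Some w"
  using assms fun_cong [OF normal, of u] by (auto simp: map_comp_def split: option.splits)

text \<open>This is \<open>T* A\<close>, which turns out to be the adjoint of \<open>B\<close>. By
  normality the range of \<open>A\<close> lies in the domain of \<open>T*\<close>, so
  \<open>the\<close> never meets \<open>None\<close>.\<close>

definition Tadj_resolvent :: "'a \<Rightarrow> 'a"
  where "Tadj_resolvent x = the (Tadj (resolvent x))"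

lemma Tadj_resolvent: "Tadj (resolvent x) = Some (Tadj_resolvent x)"
  and T_Tadj_resolvent: "T (Tadj_resolvent x) = Some (x - resolvent x)"
proof -
  obtain v where "Tadj (resolvent x) = Some v" "T v = Some (x - resolvent x)"
    by (rule normalD1 [OF T_resolvent Tadj_T_resolvent])
  then show "Tadj (resolvent x) = Some (Tadj_resolvent x)"
    and "T (Tadj_resolvent x) = Some (x - resolvent x)"
    by (simp_all add: Tadj_resolvent_def)
qed

text \<open>The pointwise form of \<open>T = A\<^sup>-\<^sup>1 B\<close>; its forward direction is
  \<open>A T \<subseteq> T A\<close>.\<close>

lemma T_eq_Some_iff: "T x = Some y \<longleftrightarrow> T_resolvent x = resolvent y"
proof
  assume "T x = Some y"
  \<comment> \<open>Since \<open>x - A x = T* B x\<close>, this computes \<open>T T* B x\<close>;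
    normality turns it into \<open>T* T B x = y - B x\<close>, so \<open>B x\<close> solves the
    equation for \<open>y\<close>.\<close>
  then have "T (x - resolvent x) = Some (y - T_resolvent x)"
    by (intro T_diff T_resolvent)
  then obtain v where "T (T_resolvent x) = Some v" "Tadj v = Some (y - T_resolvent x)"
    by (rule normalD2 [OF Tadj_T_resolvent])
  from resolvent_eq [OF this] show "T_resolvent x = resolvent y"
    by simp
next
  assume eq: "T_resolvent x = resolvent y"
  \<comment> \<open>Both sides are \<open>T*\<close> applied to \<open>B x = A y\<close>. As
    \<open>T* A y\<close> lies in the domain of \<open>T\<close>, so does \<open>x - A x\<close>,
    and with \<open>A x\<close> also \<open>x\<close>.\<close>
  then have "Tadj_resolvent y = x - resolvent x"
    using Tadj_T_resolvent [of x] Tadj_resolvent [of y] by simp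
  then have "T (x - resolvent x) = Some (y - resolvent y)"
    using T_Tadj_resolvent [of y] by simp
  from T_add [OF this T_resolvent [of x]] show "T x = Some y"
    by (simp add: eq)
qed

lemma T_resolvent_commute: "T x = Some y \<Longrightarrow> T_resolvent x = resolvent y"
  by (simp add: T_eq_Some_iff)

text \<open>\<open>T* A x\<close> solves the equation for \<open>y\<close>, because
  \<open>T T* A x = x - A x\<close> and \<open>T*\<close> maps this to
  \<open>y - T* A x\<close>.\<close>

lemma Tadj_resolvent_commute:
  assumes "Tadj x = Some y"
  shows "Tadj_resolvent x = resolvent y"
proof -
  have "Tadj (x - resolvent x) = Some (y - Tadj_resolvent x)"
    using assms by (intro Tadj_diff Tadj_resolvent)
  from resolvent_eq [OF T_Tadj_resolvent this] show ?thesis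
    by simp
qed

lemma resolvent_T_resolvent: "resolvent (T_resolvent x) = T_resolvent (resolvent x)"
  using T_resolvent_commute [OF T_resolvent] by simp

text \<open>Split \<open>y\<close> as \<open>A y + (y - A y)\<close>, where
  \<open>y - A y = T T* A y\<close>, and move \<open>T\<close> across each part; the results add up
  to \<open>ip x (T* A y)\<close>.\<close>

lemma T_resolvent_adjoint: "ip (T_resolvent x) y = ip x (Tadj_resolvent y)"
proof -
  have "ip (T_resolvent x) (resolvent y) = ip (resolvent x) (Tadj_resolvent y)"
    by (rule ip_Tadj [OF T_resolvent Tadj_resolvent])
  moreover have "ip (y - resolvent y) (T_resolvent x) = ip (Tadj_resolvent y) (x - resolvent x)"
    by (rule ip_Tadj [OF T_Tadj_resolvent Tadj_T_resolvent])
  then have "ip (T_resolvent x) (y - resolvent y) = ip (x - resolvent x) (Tadj_resolvent y)"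
    by (metis ip_commute)
  ultimately show ?thesis
    by (simp add: ip_diff_left ip_diff_right)
qed

text \<open>Commuting \<open>A\<close> to the right turns both products into
  \<open>A - A A\<close>.\<close>

lemma T_resolvent_normal: "Tadj_resolvent (T_resolvent x) = T_resolvent (Tadj_resolvent x)"
proof -
  have "Tadj (T_resolvent (resolvent x)) = Some (Tadj_resolvent (T_resolvent x))"
    using Tadj_resolvent [of "T_resolvent x"] by (simp add: resolvent_T_resolvent)
  then have 1: "Tadj_resolvent (T_resolvent x) = resolvent x - resolvent (resolvent x)"
    by (simp add: Tadj_T_resolvent)
  have "Tadj_resolvent (resolvent x) = resolvent (Tadj_resolvent x)"
    by (rule Tadj_resolvent_commute [OF Tadj_resolvent])
  then have "T (Tadj_resolvent (resolvent x)) = Some (T_resolvent (Tadj_resolvent x))"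
    by (simp add: T_resolvent)
  then show ?thesis
    by (simp add: 1 T_Tadj_resolvent)
qed

end

section \<open>Assembling \<open>A\<close> and \<open>B\<close>\<close>

lemma inverse_operator_total:
  assumes "inj f"
  shows "inverse_operator (\<lambda>x. Some (f x)) z = Some y \<longleftrightarrow> f y = z"
  using assms the_inv_into_f_f [OF assms] by (auto simp: inverse_operator_def ran_def dom_def injD)

theorem theorem1p1:
  fixes smul :: "'k::hilbert_scalar \<Rightarrow> 'a::banach \<Rightarrow> 'a"
    and ip :: "'a \<Rightarrow> 'a \<Rightarrow> 'k"
    and T :: "'a \<rightharpoonup> 'a"
  assumes "hilbert_space smul ip"
    and "linear_operator smul T"
    and "closed_operator T"
    and "normal_operator ip T"
  shows "\<exists>A\<in>bounded_operators smul. \<exists>B\<in>bounded_operators smul.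
           injective_operator A \<and>
           T = inverse_operator A \<circ>\<^sub>m B \<and>
           A \<circ>\<^sub>m B = B \<circ>\<^sub>m A \<and>
           self_adjoint_operator ip A \<and> normal_operator ip B \<and>
           (self_adjoint_operator ip T \<longrightarrow> self_adjoint_operator ip B)"
proof -
  interpret hilbert_space smul ip
    by fact
  interpret closed_normal_operator smul ip T
    using assms(2-4) by unfold_locales (auto simp: normal_operator_def)
  define A where "A = (\<lambda>x. Some (resolvent x))"
  define B where "B = (\<lambda>x. Some (T_resolvent x))"
  have adjoint_A: "adjoint_operator ip A = A"
    unfolding A_def using resolvent_self_adjoint by (rule adjoint_operator_total)
  have adjoint_B: "adjoint_operator ip B = (\<lambda>x. Some (Tadj_resolvent x))"
    unfolding B_def using T_resolvent_adjoint by (rule adjoint_operator_total)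
  have "A \<in> bounded_operators smul" "B \<in> bounded_operators smul"
    unfolding A_def B_def
    by (intro bounded_operators_total resolvent_add resolvent_scale norm_resolvent_le
        T_resolvent_add T_resolvent_scale norm_T_resolvent_le)+
  moreover have "injective_operator A"
    using inj_resolvent by (simp add: injective_operator_def A_def dom_def)
  moreover have "T = inverse_operator A \<circ>\<^sub>m B"
  proof
    fix x
    \<comment> \<open>Agreement on every \<open>Some y\<close> also settles the value
      \<open>None\<close>, so the domains coincide too.\<close>
    have "T x = Some y \<longleftrightarrow> inverse_operator A (T_resolvent x) = Some y" for y
      unfolding A_def inverse_operator_total [OF inj_resolvent] T_eq_Some_iff by auto
    then show "T x = (inverse_operator A \<circ>\<^sub>m B) x"
      by (simp add: B_def map_comp_def) (metis not_Some_eq)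
  qed
  moreover have "A \<circ>\<^sub>m B = B \<circ>\<^sub>m A"
    by (simp add: A_def B_def map_comp_def resolvent_T_resolvent)
  moreover have "self_adjoint_operator ip A"
    using adjoint_A by (simp add: self_adjoint_operator_def A_def densely_defined_total)
  moreover have "normal_operator ip B"
    unfolding normal_operator_def adjoint_B
    by (simp add: B_def densely_defined_total map_comp_def T_resolvent_normal)
  moreover have "self_adjoint_operator ip B" if "self_adjoint_operator ip T"
  proof -
    \<comment> \<open>With \<open>T* = T\<close>, the operators \<open>T* A\<close> and
      \<open>T A\<close> are the same, so \<open>B\<close> is its own adjoint.\<close>
    have "Tadj_resolvent = T_resolvent"
      using that by (simp add: fun_eq_iff self_adjoint_operator_def Tadj_resolvent_def
          T_resolvent_def)
    then show ?thesis
      using adjoint_B by (simp add: self_adjoint_operator_def B_def densely_defined_total)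
  qed
  ultimately show ?thesis
    by blast
qed

end
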